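(* Let $A$ be a cyclic group (so $A\cong\mathbb{Z}$ or $A\cong\mathbb{Z}/n\mathbb{Z}$), and let $G$ be a connected Lie group with an $A$-module structure. If $A\cong\mathbb{Z}$, assume moreover that $G$ is compact and that the $\mathbb{Z}$-module structure on $G$ is $1$-semisimple. Let $T$ be a maximal compact torus of $G^A$. Then $W(G,\sigma,T)$ is independent of the choice of the generator $\sigma$ of $A$, that is, $W(G,\sigma,T)=W(G,\sigma',T)$ for any two generators $\sigma,\sigma'$ of $A$.
   Context: An $A$-module structure on a Lie group $G$ is an action of the (discrete) group $A$ on $G$ by Lie group automorphisms; write $a(g)$ for the action of $a\in A$ on $g\in G$. An element $\sigma\in A$ is identified with the automorphism of $G$ by which it acts, and $d\sigma$ denotes the induced automorphism of the Lie algebra of $G$. When $A\cong\mathbb{Z}$, the module structure is $1$-semisimple if $\ker(1-d\sigma)=\ker((1-d\sigma)^2)$ for a generator $\sigma$ of $A$. $G^A=\{g\in G: a(g)=g\ \forall a\in A\}$. A compact torus is a compact connected abelian Lie subgroup; a maximal compact torus is one not properly contained in another. For a generator $\sigma$ of $A$, let $Z_\sigma(T)=\{g\in G: gt\sigma(g)^{-1}=t\ \forall t\in T\}$ and $N_\sigma(T)=\{g\in G: gT\sigma(g)^{-1}=T\}$; these are closed subgroups of $G$ with $Z_\sigma(T)$ normal in $N_\sigma(T)$, and $W(G,\sigma,T)=N_\sigma(T)/Z_\sigma(T)$. Equality of these groups means equality as quotient groups of subgroups of $G$ (groups of cosets in $G$), not merely abstract isomorphism. *)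

theory Defs
  imports
    "HOL-Analysis.Analysis"
    "HOL-Algebra.Elementary_Groups"
    "HOL-Algebra.Bij"
begin

section \<open>Smooth maps between open subsets of normed spaces\<close>

text \<open>Only meant for open \<open>S\<close>. On a finite-dimensional space, continuity of all directional
  derivatives is continuity of the derivative, so \<open>Ck_on n S f\<close> says that \<open>f\<close> is of class
  \<open>C\<^sup>n\<close> on \<open>S\<close>.\<close>

primrec Ck_on ::
  "nat \<Rightarrow> 'a::real_normed_vector set \<Rightarrow> ('a \<Rightarrow> 'b::real_normed_vector) \<Rightarrow> bool" where
  "Ck_on 0 S f \<longleftrightarrow> continuous_on S f"
| "Ck_on (Suc n) S f \<longleftrightarrow>
     (\<forall>x\<in>S. f differentiable (at x)) \<and>
     (\<forall>v. Ck_on n S (\<lambda>x. frechet_derivative f (at x) v))"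

definition smooth_on ::
  "'a::real_normed_vector set \<Rightarrow> ('a \<Rightarrow> 'b::real_normed_vector) \<Rightarrow> bool" where
  "smooth_on S f \<longleftrightarrow> (\<forall>n. Ck_on n S f)"


section \<open>Smooth manifolds\<close>

text \<open>A chart is a pair of its domain and its coordinate map.\<close>

type_synonym ('g, 'm) chart = "'g set \<times> ('g \<Rightarrow> 'm)"

definition is_chart :: "'g topology \<Rightarrow> ('g, 'm::real_normed_vector) chart \<Rightarrow> bool" where
  "is_chart X = (\<lambda>(U, \<phi>). openin X U \<and> open (\<phi> ` U) \<and>
     homeomorphic_map (subtopology X U) (top_of_set (\<phi> ` U)) \<phi>)"

definition compatible_charts ::
  "('g, 'm::real_normed_vector) chart \<Rightarrow> ('g, 'm) chart \<Rightarrow> bool" where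
  "compatible_charts = (\<lambda>(U, \<phi>) (V, \<psi>).
     smooth_on (\<phi> ` (U \<inter> V)) (\<psi> \<circ> inv_into U \<phi>) \<and>
     smooth_on (\<psi> ` (U \<inter> V)) (\<phi> \<circ> inv_into V \<psi>))"

text \<open>The model space is a finite-dimensional normed space rather than a member of the class
  \<open>euclidean_space\<close>, because the latter excludes dimension 0.\<close>

locale smooth_manifold =
  fixes X :: "'g topology" and \<A> :: "('g, 'm::real_normed_vector) chart set"
  assumes finite_dimensional: "\<exists>B::'m set. finite B \<and> span B = UNIV"
    and hausdorff: "Hausdorff_space X"
    and second_countable: "second_countable X"
    and charts: "c \<in> \<A> \<Longrightarrow> is_chart X c"
    and compatible: "\<lbrakk>c \<in> \<A>; d \<in> \<A>\<rbrakk> \<Longrightarrow> compatible_charts c d"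
    and covers: "(\<Union>c\<in>\<A>. fst c) = topspace X"

definition maximal_atlas ::
  "'g topology \<Rightarrow> ('g, 'm::real_normed_vector) chart set \<Rightarrow> ('g, 'm) chart set" where
  "maximal_atlas X \<A> = {c. is_chart X c \<and> (\<forall>d\<in>\<A>. compatible_charts c d)}"

definition smooth_map ::
  "'g topology \<Rightarrow> ('g, 'm::real_normed_vector) chart set \<Rightarrow>
   'h topology \<Rightarrow> ('h, 'n::real_normed_vector) chart set \<Rightarrow> ('g \<Rightarrow> 'h) \<Rightarrow> bool" where
  "smooth_map X \<A> Y \<B> f \<longleftrightarrow> continuous_map X Y f \<and>
     (\<forall>(U, \<phi>)\<in>\<A>. \<forall>(V, \<psi>)\<in>\<B>.
        smooth_on (\<phi> ` (U \<inter> f -` V)) (\<psi> \<circ> f \<circ> inv_into U \<phi>))"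

definition prod_atlas ::
  "('g, 'm) chart set \<Rightarrow> ('h, 'n) chart set \<Rightarrow> ('g \<times> 'h, 'm \<times> 'n) chart set" where
  "prod_atlas \<A> \<B> = {(U \<times> V, map_prod \<phi> \<psi>) |U \<phi> V \<psi>. (U, \<phi>) \<in> \<A> \<and> (V, \<psi>) \<in> \<B>}"


section \<open>Tangent spaces and differentials\<close>

definition smooth_functions ::
  "'g topology \<Rightarrow> ('g, 'm::real_normed_vector) chart set \<Rightarrow> ('g \<Rightarrow> real) set" where
  "smooth_functions X \<A> = {f. smooth_map X \<A> euclideanreal {(UNIV, id)} f}"

text \<open>Tangent vectors at \<open>p\<close> are derivations at \<open>p\<close> of the algebra of smooth functions, extended by 0
  to functions that are not smooth so that they are determined by their values on smooth ones.
  The values of \<open>f\<close> outside \<open>topspace X\<close> do not matter: if \<open>f\<close> and \<open>g\<close> agree on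
  \<open>topspace X\<close>, then \<open>h = f - g\<close> satisfies \<open>h = h * k\<close> for the indicator function \<open>k\<close> of the
  complement of \<open>topspace X\<close>, and the Leibniz rule gives \<open>D h = 0\<close>.\<close>

definition tangent_space ::
  "'g topology \<Rightarrow> ('g, 'm::real_normed_vector) chart set \<Rightarrow> 'g \<Rightarrow> (('g \<Rightarrow> real) \<Rightarrow> real) set" where
  "tangent_space X \<A> p = {D.
     (\<forall>f\<in>smooth_functions X \<A>. \<forall>g\<in>smooth_functions X \<A>.
        D (\<lambda>x. f x + g x) = D f + D g \<and>
        D (\<lambda>x. f x * g x) = f p * D g + g p * D f) \<and>
     (\<forall>f\<in>smooth_functions X \<A>. \<forall>c. D (\<lambda>x. c * f x) = c * D f) \<and>
     (\<forall>f. f \<notin> smooth_functions X \<A> \<longrightarrow> D f = 0)}"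

definition differential ::
  "'h topology \<Rightarrow> ('h, 'n::real_normed_vector) chart set \<Rightarrow> ('g \<Rightarrow> 'h) \<Rightarrow>
   (('g \<Rightarrow> real) \<Rightarrow> real) \<Rightarrow> (('h \<Rightarrow> real) \<Rightarrow> real)" where
  "differential Y \<B> \<alpha> D = (\<lambda>f. if f \<in> smooth_functions Y \<B> then D (f \<circ> \<alpha>) else 0)"


section \<open>Lie groups\<close>

locale lie_group = group G + smooth_manifold X \<A>
  for G :: "('g, 'x) monoid_scheme" (structure)
    and X :: "'g topology" and \<A> :: "('g, 'm::real_normed_vector) chart set" +
  assumes topspace_eq: "topspace X = carrier G"
    and smooth_mult:
      "smooth_map (prod_topology X X) (prod_atlas \<A> \<A>) X \<A> (\<lambda>(x, y). x \<otimes> y)"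
    and smooth_inv: "smooth_map X \<A> X \<A> (\<lambda>x. inv x)"

text \<open>Only the vector space underlying the Lie algebra is needed below, so the bracket is not
  introduced.\<close>

definition lie_algebra ::
  "('g, 'x) monoid_scheme \<Rightarrow> 'g topology \<Rightarrow> ('g, 'm::real_normed_vector) chart set \<Rightarrow>
   (('g \<Rightarrow> real) \<Rightarrow> real) set" where
  "lie_algebra G X \<A> = tangent_space X \<A> \<one>\<^bsub>G\<^esub>"

definition lie_automorphisms ::
  "('g, 'x) monoid_scheme \<Rightarrow> 'g topology \<Rightarrow> ('g, 'm::real_normed_vector) chart set \<Rightarrow>
   ('g \<Rightarrow> 'g) set" where
  "lie_automorphisms G X \<A> =
     {\<alpha> \<in> auto G. smooth_map X \<A> X \<A> \<alpha> \<and> smooth_map X \<A> X \<A> (inv_into (carrier G) \<alpha>)}"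

text \<open>Lie subgroups are taken to be embedded; the domains of slice charts come from the maximal
  atlas. For compact subgroups there is no difference to immersed Lie subgroups.\<close>

definition lie_subgroup ::
  "('g, 'x) monoid_scheme \<Rightarrow> 'g topology \<Rightarrow> ('g, 'm::real_normed_vector) chart set \<Rightarrow>
   'g set \<Rightarrow> bool" where
  "lie_subgroup G X \<A> H \<longleftrightarrow> subgroup H G \<and>
     (\<exists>E::'m set. subspace E \<and>
       (\<forall>p\<in>H. \<exists>(U, \<phi>)\<in>maximal_atlas X \<A>. p \<in> U \<and> \<phi> ` (U \<inter> H) = \<phi> ` U \<inter> E))"

definition compact_torus ::
  "('g, 'x) monoid_scheme \<Rightarrow> 'g topology \<Rightarrow> ('g, 'm::real_normed_vector) chart set \<Rightarrow>
   'g set \<Rightarrow> bool" where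
  "compact_torus G X \<A> T \<longleftrightarrow> lie_subgroup G X \<A> T \<and> compactin X T \<and> connectedin X T \<and>
     (\<forall>s\<in>T. \<forall>t\<in>T. s \<otimes>\<^bsub>G\<^esub> t = t \<otimes>\<^bsub>G\<^esub> s)"

text \<open>Here \<open>H\<close> is a closed subgroup of the Lie group \<open>G\<close>; the Lie subgroups of \<open>H\<close> are
  those of \<open>G\<close> that are contained in \<open>H\<close>.\<close>

definition maximal_compact_torus ::
  "('g, 'x) monoid_scheme \<Rightarrow> 'g topology \<Rightarrow> ('g, 'm::real_normed_vector) chart set \<Rightarrow>
   'g set \<Rightarrow> 'g set \<Rightarrow> bool" where
  "maximal_compact_torus G X \<A> H T \<longleftrightarrow> compact_torus G X \<A> T \<and> T \<subseteq> H \<and>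
     \<not> (\<exists>T'. compact_torus G X \<A> T' \<and> T' \<subseteq> H \<and> T \<subset> T')"


section \<open>Module structures on Lie groups\<close>

definition lie_module ::
  "('a, 'y) monoid_scheme \<Rightarrow> ('a \<Rightarrow> 'g \<Rightarrow> 'g) \<Rightarrow>
   ('g, 'x) monoid_scheme \<Rightarrow> 'g topology \<Rightarrow> ('g, 'm::real_normed_vector) chart set \<Rightarrow> bool" where
  "lie_module A act G X \<A> \<longleftrightarrow>
     act \<in> hom A (AutoGroup G) \<and> act ` carrier A \<subseteq> lie_automorphisms G X \<A>"

definition fixed_points ::
  "('a, 'y) monoid_scheme \<Rightarrow> ('a \<Rightarrow> 'g \<Rightarrow> 'g) \<Rightarrow> ('g, 'x) monoid_scheme \<Rightarrow> 'g set" where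
  "fixed_points A act G = {g \<in> carrier G. \<forall>a\<in>carrier A. act a g = g}"

definition generator :: "('a, 'y) monoid_scheme \<Rightarrow> 'a \<Rightarrow> bool" where
  "generator A \<sigma> \<longleftrightarrow> \<sigma> \<in> carrier A \<and> subgroup_generated A {\<sigma>} = A"

text \<open>\<open>id_minus L\<close> is the operator \<open>1 - L\<close> on functionals.\<close>

definition id_minus ::
  "((('g \<Rightarrow> real) \<Rightarrow> real) \<Rightarrow> (('g \<Rightarrow> real) \<Rightarrow> real)) \<Rightarrow>
   (('g \<Rightarrow> real) \<Rightarrow> real) \<Rightarrow> (('g \<Rightarrow> real) \<Rightarrow> real)" where
  "id_minus L D = (\<lambda>f. D f - L D f)"

text \<open>For infinite cyclic \<open>A\<close> the choice of the generator is irrelevant: the only other generator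
  is the inverse, and \<open>1 - d\<sigma>\<close> differs from \<open>1 - d\<sigma>\<close> for the inverse by the
  invertible factor \<open>-d\<sigma>\<close>, which commutes with both.\<close>

definition one_semisimple ::
  "('a, 'y) monoid_scheme \<Rightarrow> ('a \<Rightarrow> 'g \<Rightarrow> 'g) \<Rightarrow>
   ('g, 'x) monoid_scheme \<Rightarrow> 'g topology \<Rightarrow> ('g, 'm::real_normed_vector) chart set \<Rightarrow> bool" where
  "one_semisimple A act G X \<A> \<longleftrightarrow> (\<exists>\<sigma>. generator A \<sigma> \<and>
     (let \<delta> = id_minus (differential X \<A> (act \<sigma>)) in
       {D \<in> lie_algebra G X \<A>. \<delta> D = (\<lambda>_. 0)} =
       {D \<in> lie_algebra G X \<A>. (\<delta> ^^ 2) D = (\<lambda>_. 0)}))"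


section \<open>Twisted Weyl groups\<close>

definition twisted_centralizer ::
  "('g, 'x) monoid_scheme \<Rightarrow> ('g \<Rightarrow> 'g) \<Rightarrow> 'g set \<Rightarrow> 'g set" where
  "twisted_centralizer G \<alpha> T =
     {g \<in> carrier G. \<forall>t\<in>T. g \<otimes>\<^bsub>G\<^esub> t \<otimes>\<^bsub>G\<^esub> inv\<^bsub>G\<^esub> (\<alpha> g) = t}"

definition twisted_normalizer ::
  "('g, 'x) monoid_scheme \<Rightarrow> ('g \<Rightarrow> 'g) \<Rightarrow> 'g set \<Rightarrow> 'g set" where
  "twisted_normalizer G \<alpha> T =
     {g \<in> carrier G. (\<lambda>t. g \<otimes>\<^bsub>G\<^esub> t \<otimes>\<^bsub>G\<^esub> inv\<^bsub>G\<^esub> (\<alpha> g)) ` T = T}"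

text \<open>The elements of this group are cosets in \<open>G\<close>; an equation between two such groups means
  that they have the same cosets, the same multiplication and the same unit coset.\<close>

definition twisted_weyl_group ::
  "('g, 'x) monoid_scheme \<Rightarrow> ('g \<Rightarrow> 'g) \<Rightarrow> 'g set \<Rightarrow> 'g set monoid" where
  "twisted_weyl_group G \<alpha> T =
     G\<lparr>carrier := twisted_normalizer G \<alpha> T\<rparr> Mod twisted_centralizer G \<alpha> T"

end

theory Submission
  imports Defs
begin

text \<open>Taking \<open>t = 1\<close> in the definitions shows that the twisted centralizer of \<open>T\<close> consists of the
  \<open>\<sigma>\<close>-fixed elements of the centralizer of \<open>T\<close>, and the twisted normalizer of those \<open>g\<close> in the
  normalizer of \<open>T\<close> with \<open>\<sigma>(g) \<in> T g\<close>. Since \<open>A\<close> fixes \<open>T\<close> pointwise, \<open>\<sigma>(g) = s g\<close> implies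
  \<open>\<sigma>\<^sup>k(g) = s\<^sup>k g\<close>, so both conditions hold for one generator iff they hold for all of \<open>A\<close>.\<close>

text \<open>This form confines \<open>\<alpha>\<close> to the condition
  \<open>\<alpha> g = g\<close>, the only part that has to be compared between generators.\<close>

lemma (in group) twisted_centralizer_eq:
  assumes T: "subgroup T G" and \<alpha>: "\<alpha> \<in> carrier G \<rightarrow> carrier G"
  shows "twisted_centralizer G \<alpha> T =
    {g \<in> carrier G. \<alpha> g = g \<and> (\<forall>t\<in>T. g \<otimes> t = t \<otimes> g)}"
proof -
  have "(\<forall>t\<in>T. g \<otimes> t \<otimes> inv (\<alpha> g) = t) \<longleftrightarrow> \<alpha> g = g \<and> (\<forall>t\<in>T. g \<otimes> t = t \<otimes> g)"
    if g: "g \<in> carrier G" for g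
  proof -
    have ag: "\<alpha> g \<in> carrier G" using \<alpha> g by auto
    have eq: "g \<otimes> t \<otimes> inv (\<alpha> g) = t \<longleftrightarrow> g \<otimes> t = t \<otimes> \<alpha> g" if "t \<in> T" for t
      using inv_solve_right'[of t "g \<otimes> t" "\<alpha> g"] g ag subgroup.mem_carrier[OF T that] by auto
    have "\<alpha> g = g" if "\<forall>t\<in>T. g \<otimes> t = t \<otimes> \<alpha> g"
      using that subgroup.one_closed[OF T] g ag by fastforce
    then show ?thesis using eq by auto
  qed
  then show ?thesis unfolding twisted_centralizer_def by blast
qed

lemma (in group) right_translation_image:
  assumes T: "subgroup T G" and s: "s \<in> T"
  shows "(\<lambda>t. t \<otimes> s) ` T = T"
proof (intro equalityI subsetI)
  fix t assume "t \<in> T"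
  then have "t = (t \<otimes> inv s) \<otimes> s" "t \<otimes> inv s \<in> T"
    using subgroup.mem_carrier[OF T] subgroup.m_closed[OF T] subgroup.m_inv_closed[OF T] s
    by (auto simp: m_assoc)
  then show "t \<in> (\<lambda>t. t \<otimes> s) ` T" by blast
qed (use subgroup.m_closed[OF T] s in auto)

text \<open>Once \<open>\<alpha> g = s \<otimes> g\<close> with \<open>s\<close> in
  \<open>T\<close>, twisted conjugation is ordinary conjugation followed by right translation by
  \<open>inv s\<close>, which permutes \<open>T\<close>.\<close>

lemma (in group) twisted_normalizer_eq:
  assumes T: "subgroup T G" and \<alpha>: "\<alpha> \<in> carrier G \<rightarrow> carrier G"
  shows "twisted_normalizer G \<alpha> T =
    {g \<in> carrier G. (\<lambda>t. g \<otimes> t \<otimes> inv g) ` T = T \<and> (\<exists>s\<in>T. \<alpha> g = s \<otimes> g)}"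
proof -
  have "(\<lambda>t. g \<otimes> t \<otimes> inv (\<alpha> g)) ` T = T \<longleftrightarrow>
      (\<lambda>t. g \<otimes> t \<otimes> inv g) ` T = T \<and> (\<exists>s\<in>T. \<alpha> g = s \<otimes> g)" (is "?tw = T \<longleftrightarrow> ?conj = T \<and> _")
    if g: "g \<in> carrier G" for g
  proof -
    have ag: "\<alpha> g \<in> carrier G" using \<alpha> g by auto
    note Tc = subgroup.mem_carrier[OF T]
    \<comment> \<open>Both follow from
      \<open>inv (\<alpha> g) = inv g \<otimes> inv s\<close>.\<close>
    have tw: "?tw = (\<lambda>t. t \<otimes> inv s) ` ?conj" and conj: "?conj = (\<lambda>t. t \<otimes> s) ` ?tw"
      if s: "s \<in> T" "\<alpha> g = s \<otimes> g" for s
      unfolding image_image using Tc s g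
      by (auto simp: inv_mult_group m_assoc intro!: image_cong)
    have "\<exists>s\<in>T. \<alpha> g = s \<otimes> g" if "?tw = T"
    proof
      \<comment> \<open>The value at \<open>t = \<one>\<close> lies in \<open>T\<close>; its inverse
        is the required \<open>s\<close>.\<close>
      have "g \<otimes> \<one> \<otimes> inv (\<alpha> g) \<in> T" using that subgroup.one_closed[OF T] by blast
      then have "inv (g \<otimes> inv (\<alpha> g)) \<in> T" using g subgroup.m_inv_closed[OF T] by simp
      then show "\<alpha> g \<otimes> inv g \<in> T" using g ag by (simp add: inv_mult_group)
      show "\<alpha> g = \<alpha> g \<otimes> inv g \<otimes> g" using g ag by (simp add: m_assoc)
    qed
    moreover have "?tw = T \<longleftrightarrow> ?conj = T" if s: "s \<in> T" "\<alpha> g = s \<otimes> g" for s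
    proof
      assume "?tw = T"
      then show "?conj = T" using conj[OF s] right_translation_image[OF T s(1)] by simp
    next
      assume "?conj = T"
      then show "?tw = T"
        using tw[OF s] right_translation_image[OF T subgroup.m_inv_closed[OF T s(1)]] by simp
    qed
    ultimately show ?thesis by blast
  qed
  then show ?thesis unfolding twisted_normalizer_def by blast
qed

text \<open>This replaces induction on powers of \<open>\<sigma>\<close>: a property passes from a
  generator to all of \<open>A\<close> as soon as the elements having it form a subgroup.\<close>

lemma generated_subgroup_eq_carrier:
  assumes "group A" and "generator A \<sigma>" and "subgroup H A" and "\<sigma> \<in> H"
  shows "H = carrier A"
proof
  show "H \<subseteq> carrier A" using assms(3) by (rule subgroup.subset)
  have "carrier A = generate A (carrier A \<inter> {\<sigma>})"
    using assms(2) carrier_subgroup_generated[of A "{\<sigma>}"] by (simp add: generator_def)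
  also have "\<dots> \<subseteq> H" using assms by (intro group.generate_subgroup_incl) auto
  finally show "carrier A \<subseteq> H" .
qed

text \<open>Closure under products and inverses encodes the formula for
  \<open>\<sigma>\<^sup>k(g)\<close> with \<open>k\<close> of either sign, uniformly for finite and
  infinite \<open>A\<close>.\<close>

lemma subgroup_translating:
  fixes A (structure) and G (structure)
  assumes "group A" and "group G" and act: "act \<in> hom A (AutoGroup G)"
    and T: "subgroup T G" and fixed: "T \<subseteq> fixed_points A act G" and g: "g \<in> carrier G"
  shows "subgroup {a \<in> carrier A. \<exists>s\<in>T. act a g = s \<otimes>\<^bsub>G\<^esub> g} A"
proof -
  interpret A: group A by fact
  interpret G: group G by fact
  interpret group_hom A "AutoGroup G" act
    by (intro group_hom.intro group_hom_axioms.intro A.is_group G.AutoGroup act)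
  have auto: "act a \<in> hom G G" if "a \<in> carrier A" for a
    using hom_closed[OF that] by (auto simp: AutoGroup_def auto_def)
  \<comment> \<open>Product and unit of \<open>AutoGroup G\<close> are composition and identity
    restricted to \<open>carrier G\<close>, so the action laws are stated for points of the
    carrier.\<close>
  have mult: "act (a \<otimes>\<^bsub>A\<^esub> b) x = act a (act b x)"
    if "a \<in> carrier A" "b \<in> carrier A" "x \<in> carrier G" for a b x
    using hom_mult[of a b] that hom_closed
    by (auto simp: AutoGroup_def BijGroup_def auto_def compose_def)
  have one: "act \<one>\<^bsub>A\<^esub> x = x" if "x \<in> carrier G" for x
    using hom_one that by (simp add: AutoGroup_def BijGroup_def)
  \<comment> \<open>As a homomorphism fixing \<open>s\<close>, \<open>act a\<close> commutes with
    left translation by \<open>s\<close>.\<close>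
  have translate: "act a (s \<otimes>\<^bsub>G\<^esub> x) = s \<otimes>\<^bsub>G\<^esub> act a x"
    if "a \<in> carrier A" "s \<in> T" "x \<in> carrier G" for a s x
    using Group.hom_mult[OF auto[OF that(1)], of s x] that fixed by (auto simp: fixed_points_def)
  note Tc = subgroup.mem_carrier[OF T]
  show ?thesis
  proof (rule A.subgroupI)
    show "{a \<in> carrier A. \<exists>s\<in>T. act a g = s \<otimes>\<^bsub>G\<^esub> g} \<noteq> {}"
      using one[OF g] g subgroup.one_closed[OF T] by force
  next
    fix a assume "a \<in> {a \<in> carrier A. \<exists>s\<in>T. act a g = s \<otimes>\<^bsub>G\<^esub> g}"
    then obtain s where a: "a \<in> carrier A" and s: "s \<in> T" "act a g = s \<otimes>\<^bsub>G\<^esub> g" by auto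
    have ag: "act (inv\<^bsub>A\<^esub> a) g \<in> carrier G" using a g auto hom_in_carrier A.inv_closed by metis
    \<comment> \<open>Applying the inverse of \<open>a\<close> to \<open>act a g = s g\<close> and
      solving for the image of \<open>g\<close> gives the translating element
      \<open>inv s\<close>.\<close>
    have "g = act (inv\<^bsub>A\<^esub> a) (act a g)" using mult[of "inv\<^bsub>A\<^esub> a" a g] a g one by simp
    also have "\<dots> = s \<otimes>\<^bsub>G\<^esub> act (inv\<^bsub>A\<^esub> a) g"
      unfolding s(2) using a s(1) g by (intro translate A.inv_closed)
    finally have "act (inv\<^bsub>A\<^esub> a) g = inv\<^bsub>G\<^esub> s \<otimes>\<^bsub>G\<^esub> g"
      using G.inv_solve_left[OF ag Tc[OF s(1)] g] by simp
    then show "inv\<^bsub>A\<^esub> a \<in> {a \<in> carrier A. \<exists>s\<in>T. act a g = s \<otimes>\<^bsub>G\<^esub> g}"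
      using a s subgroup.m_inv_closed[OF T] by auto
  next
    fix a b
    assume "a \<in> {a \<in> carrier A. \<exists>s\<in>T. act a g = s \<otimes>\<^bsub>G\<^esub> g}"
      and "b \<in> {a \<in> carrier A. \<exists>s\<in>T. act a g = s \<otimes>\<^bsub>G\<^esub> g}"
    then obtain s t where a: "a \<in> carrier A" "s \<in> T" "act a g = s \<otimes>\<^bsub>G\<^esub> g"
      and b: "b \<in> carrier A" "t \<in> T" "act b g = t \<otimes>\<^bsub>G\<^esub> g" by auto
    \<comment> \<open>Here \<open>act a (t g) = t (act a g)\<close>, hence the order
      \<open>t\<close>, \<open>s\<close>.\<close>
    have "act (a \<otimes>\<^bsub>A\<^esub> b) g = (t \<otimes>\<^bsub>G\<^esub> s) \<otimes>\<^bsub>G\<^esub> g"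
      using mult translate a b g Tc by (simp add: G.m_assoc)
    then show "a \<otimes>\<^bsub>A\<^esub> b \<in> {a \<in> carrier A. \<exists>s\<in>T. act a g = s \<otimes>\<^bsub>G\<^esub> g}"
      using a b subgroup.m_closed[OF T] by auto
  qed simp
qed

theorem proposition4p1:
  fixes A :: "('a, 'y) monoid_scheme"
    and G :: "('g, 'x) monoid_scheme"
    and X :: "'g topology"
    and \<A> :: "('g, 'm::real_normed_vector) chart set"
    and act :: "'a \<Rightarrow> 'g \<Rightarrow> 'g"
    and T :: "'g set"
    and \<sigma> \<sigma>' :: 'a
  assumes "group A" and "cyclic_group A"
    and "lie_group G X \<A>" and "connected_space X"
    and "lie_module A act G X \<A>"
    and "A \<cong> integer_group \<Longrightarrow> compact_space X \<and> one_semisimple A act G X \<A>"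
    and "maximal_compact_torus G X \<A> (fixed_points A act G) T"
    and "generator A \<sigma>" and "generator A \<sigma>'"
  shows "twisted_weyl_group G (act \<sigma>) T = twisted_weyl_group G (act \<sigma>') T"
proof -
  interpret G: lie_group G X \<A> by fact
  have act: "act \<in> hom A (AutoGroup G)" using assms(5) by (simp add: lie_module_def)
  have T: "subgroup T G" and fixed: "T \<subseteq> fixed_points A act G"
    using assms(7) by (auto simp: maximal_compact_torus_def compact_torus_def lie_subgroup_def)
  have map: "act \<tau> \<in> carrier G \<rightarrow> carrier G" if "generator A \<tau>" for \<tau>
    using act that by (auto simp: hom_def AutoGroup_def auto_def generator_def)
  \<comment> \<open>The subgroup \<open>S\<close> is left variable: \<open>S = T\<close> serves the
    normalizer, the trivial subgroup the centralizer.\<close>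
  have translating: "(\<exists>s\<in>S. act \<tau> g = s \<otimes>\<^bsub>G\<^esub> g) \<longleftrightarrow>
      (\<forall>a\<in>carrier A. \<exists>s\<in>S. act a g = s \<otimes>\<^bsub>G\<^esub> g)"
    if "generator A \<tau>" "g \<in> carrier G" "subgroup S G" "S \<subseteq> T" for \<tau> g S
    using generated_subgroup_eq_carrier[OF assms(1) that(1)
        subgroup_translating[OF assms(1) G.is_group act that(3) _ that(2)]]
      that fixed by (auto simp: generator_def)
  have fixing: "act \<tau> g = g \<longleftrightarrow> (\<forall>a\<in>carrier A. act a g = g)"
    if "generator A \<tau>" "g \<in> carrier G" for \<tau> g
    using translating[OF that G.triv_subgroup] subgroup.one_closed[OF T] that by simp
  have "twisted_centralizer G (act \<sigma>) T = twisted_centralizer G (act \<sigma>') T"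
    unfolding G.twisted_centralizer_eq[OF T map[OF assms(8)]]
      G.twisted_centralizer_eq[OF T map[OF assms(9)]]
    using fixing[OF assms(8)] fixing[OF assms(9)] by blast
  moreover have "twisted_normalizer G (act \<sigma>) T = twisted_normalizer G (act \<sigma>') T"
    unfolding G.twisted_normalizer_eq[OF T map[OF assms(8)]]
      G.twisted_normalizer_eq[OF T map[OF assms(9)]]
    \<comment> \<open>The congruence rule passes on \<open>g \<in> carrier G\<close>, a premise of
      \<open>translating\<close>.\<close>
    by (simp add: translating[OF assms(8) _ T] translating[OF assms(9) _ T] cong: conj_cong)
  \<comment> \<open>The quotient depends on the generator only through these two subsets of
    \<open>G\<close>.\<close>
  ultimately show ?thesis by (simp add: twisted_weyl_group_def)
qed

end
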